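(* Let $(\mathcal C,\mathcal D)$ be an inclusion and let $\mathcal U(\mathcal C)$ be the unitary group of $\mathcal C$. Assume that $\mathcal U(\mathcal C)\subseteq\mathcal N(\mathcal C,\mathcal D)$. Then $(\mathcal C,\mathcal D)$ is regular and $\mathfrak S(\mathcal C,\mathcal D)$ is the set of all multiplicative linear functionals on $\mathcal C$.
   Context: All $C^*$-algebras are unital. An inclusion is a pair $(\mathcal C,\mathcal D)$ where $\mathcal C$ is a unital $C^*$-algebra and $\mathcal D\subseteq\mathcal C$ is an abelian $C^*$-subalgebra containing the unit of $\mathcal C$. Its normalizers are $\mathcal N(\mathcal C,\mathcal D)=\{v\in\mathcal C: v^*\mathcal Dv\cup v\mathcal Dv^*\subseteq\mathcal D\}$. The inclusion is regular if $\operatorname{span}\mathcal N(\mathcal C,\mathcal D)$ is norm dense in $\mathcal C$. $\mathfrak S(\mathcal C,\mathcal D)$ is the set of $\mathcal D$-compatible states, i.e. states $\rho$ on $\mathcal C$ with $|\rho(v)|^2\in\{0,\rho(v^*v)\}$ for every $v\in\mathcal N(\mathcal C,\mathcal D)$. Multiplicative linear functionals (characters) are understood to be nonzero; there may be none, in which case $\mathfrak S(\mathcal C,\mathcal D)=\emptyset$. *)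

theory Defs
  imports "HOL-Analysis.Analysis"
begin

text \<open>
  The underlying Banach algebra structure is inherited from the real classes of the library;
  complex scalars and the involution are added. In particular \<open>norm 1 = 1\<close>, so the algebra
  is nonzero.
\<close>

class cstar_algebra = real_normed_algebra_1 + banach +
  fixes scaleC :: "complex \<Rightarrow> 'a \<Rightarrow> 'a"  (infixr \<open>*\<^sub>C\<close> 75)
    and star :: "'a \<Rightarrow> 'a"
  assumes scaleC_add_right: "c *\<^sub>C (a + b) = c *\<^sub>C a + c *\<^sub>C b"
    and scaleC_add_left: "(c + d) *\<^sub>C a = c *\<^sub>C a + d *\<^sub>C a"
    and scaleC_scaleC: "c *\<^sub>C d *\<^sub>C a = (c * d) *\<^sub>C a"
    and scaleC_complex_of_real: "complex_of_real r *\<^sub>C a = r *\<^sub>R a"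
    and mult_scaleC_left: "(c *\<^sub>C a) * b = c *\<^sub>C (a * b)"
    and mult_scaleC_right: "a * (c *\<^sub>C b) = c *\<^sub>C (a * b)"
    and norm_scaleC: "norm (c *\<^sub>C a) = cmod c * norm a"
    and star_star: "star (star a) = a"
    and star_add: "star (a + b) = star a + star b"
    and star_scaleC: "star (c *\<^sub>C a) = cnj c *\<^sub>C star a"
    and star_mult: "star (a * b) = star b * star a"
    and norm_star_mult_self: "norm (star a * a) = (norm a)\<^sup>2"

instantiation complex :: cstar_algebra
begin

definition scaleC_complex :: "complex \<Rightarrow> complex \<Rightarrow> complex"
  where "scaleC_complex c z = c * z"

definition star_complex :: "complex \<Rightarrow> complex"
  where "star_complex z = cnj z"

instance
  by standard
    (simp_all add: scaleC_complex_def star_complex_def algebra_simps scaleR_conv_of_real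
      norm_mult power2_eq_square)

end

global_interpretation complex_vector: vector_space "scaleC :: complex \<Rightarrow> 'a \<Rightarrow> 'a::cstar_algebra"
proof
  fix c d :: complex and a b :: 'a
  show "c *\<^sub>C (a + b) = c *\<^sub>C a + c *\<^sub>C b" by (rule scaleC_add_right)
  show "(c + d) *\<^sub>C a = c *\<^sub>C a + d *\<^sub>C a" by (rule scaleC_add_left)
  show "c *\<^sub>C d *\<^sub>C a = (c * d) *\<^sub>C a" by (rule scaleC_scaleC)
  show "1 *\<^sub>C a = a" using scaleC_complex_of_real[of 1 a] by simp
qed

definition cstar_subalgebra :: "'a::cstar_algebra set \<Rightarrow> bool"
  where "cstar_subalgebra D \<longleftrightarrow>
    complex_vector.subspace D \<and> closed D \<and>
    (\<forall>a\<in>D. \<forall>b\<in>D. a * b \<in> D) \<and> (\<forall>a\<in>D. star a \<in> D)"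

text \<open>The ambient algebra \<open>\<C>\<close> of an inclusion is the whole type.\<close>

definition inclusion :: "'a::cstar_algebra set \<Rightarrow> bool"
  where "inclusion D \<longleftrightarrow>
    cstar_subalgebra D \<and> 1 \<in> D \<and> (\<forall>a\<in>D. \<forall>b\<in>D. a * b = b * a)"

definition normalizers :: "'a::cstar_algebra set \<Rightarrow> 'a set"
  where "normalizers D =
    {v. (\<lambda>d. star v * d * v) ` D \<union> (\<lambda>d. v * d * star v) ` D \<subseteq> D}"

definition regular_inclusion :: "'a::cstar_algebra set \<Rightarrow> bool"
  where "regular_inclusion D \<longleftrightarrow>
    inclusion D \<and> closure (complex_vector.span (normalizers D)) = UNIV"

definition unitaries :: "'a::cstar_algebra set"
  where "unitaries = {u. star u * u = 1 \<and> u * star u = 1}"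

abbreviation clinear_functional :: "('a::cstar_algebra \<Rightarrow> complex) \<Rightarrow> bool"
  where "clinear_functional \<equiv> Vector_Spaces.linear scaleC (*)"

text \<open>Positive elements of a C*-algebra are those of the form \<open>star a * a\<close>.\<close>

definition state :: "('a::cstar_algebra \<Rightarrow> complex) \<Rightarrow> bool"
  where "state \<rho> \<longleftrightarrow>
    clinear_functional \<rho> \<and> (\<forall>a. \<rho> (star a * a) \<in> \<real>\<^sub>\<ge>\<^sub>0) \<and> \<rho> 1 = 1"

definition compatible_states :: "'a::cstar_algebra set \<Rightarrow> ('a \<Rightarrow> complex) set"
  where "compatible_states D =
    {\<rho>. state \<rho> \<and>
      (\<forall>v\<in>normalizers D. complex_of_real ((cmod (\<rho> v))\<^sup>2) \<in> {0, \<rho> (star v * v)})}"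

definition characters :: "('a::cstar_algebra \<Rightarrow> complex) set"
  where "characters =
    {\<phi>. clinear_functional \<phi> \<and> (\<forall>a b. \<phi> (a * b) = \<phi> a * \<phi> b) \<and> \<phi> \<noteq> (\<lambda>_. 0)}"

end

theory Submission
  imports Defs
begin

text \<open>
  Every element is \<open>h + i k\<close> with \<open>h\<close>, \<open>k\<close> self-adjoint, and a self-adjoint \<open>h\<close> is the limit of
  \<open>(exp (i t h) - 1) / (i t)\<close>, so the unitaries \<open>exp (i h)\<close> already span a dense subspace.
  If \<open>\<rho>\<close> is a compatible state, then \<open>t \<mapsto> \<bar>\<rho> (exp (i t h))\<bar>\<close> is continuous with
  values in \<open>{0, 1}\<close>, hence constantly \<open>1\<close>. By Cauchy--Schwarz a state is multiplicative at a
  unitary on which it has modulus \<open>1\<close>, and density makes it multiplicative everywhere.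
  Conversely a character is contractive and Hermitian, so it satisfies
  \<open>\<phi> (star v * v) = \<bar>\<phi> v\<bar>\<^sup>2\<close> for every \<open>v\<close>.
\<close>

section \<open>Basic rules for the involution\<close>

lemma star_zero [simp]: "star (0 :: 'a::cstar_algebra) = 0"
  using star_add[of "0 :: 'a" 0] by simp

lemma star_minus [simp]: "star (- a :: 'a::cstar_algebra) = - star a"
  using star_add[of a "- a"] by (simp add: eq_neg_iff_add_eq_0 add.commute)

lemma star_diff: "star (a - b :: 'a::cstar_algebra) = star a - star b"
  using star_add[of a "- b"] by simp

lemma star_one [simp]: "star (1 :: 'a::cstar_algebra) = 1"
  using star_mult[of "star 1 :: 'a" 1] by (simp add: star_star)

lemma star_scaleR: "star (r *\<^sub>R a :: 'a::cstar_algebra) = r *\<^sub>R star a"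
  using star_scaleC[of "complex_of_real r" a] by (simp add: scaleC_complex_of_real)

lemma star_power: "star (a ^ n :: 'a::cstar_algebra) = star a ^ n"
  by (induction n) (simp_all add: star_mult power_commutes)

text \<open>The C*-identity and submultiplicativity bound the square of \<open>norm b\<close> by
  \<open>norm (star b) * norm b\<close>. Cancelling \<open>norm b\<close> and using both
  \<open>a\<close> and \<open>star a\<close> gives the two inequalities.\<close>

lemma norm_star [simp]: "norm (star a :: 'a::cstar_algebra) = norm a"
proof -
  have le: "norm b \<le> norm (star b)" for b :: 'a
  proof (cases "b = 0")
    case False
    have "norm b * norm b \<le> norm (star b) * norm b"
      using norm_mult_ineq[of "star b" b] by (simp add: norm_star_mult_self power2_eq_square)
    with False show ?thesis by simp
  qed simp
  show ?thesis using le[of a] le[of "star a"] by (simp add: star_star)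
qed

lemma bounded_linear_star: "bounded_linear (star :: 'a::cstar_algebra \<Rightarrow> 'a)"
  by (rule bounded_linear_intro[of _ 1]) (simp_all add: star_add star_scaleR)

section \<open>Exponentials of skew-adjoint elements and the closed subspace they generate\<close>

lemma star_exp: "star (exp a :: 'a::cstar_algebra) = exp (star a)"
proof -
  have "(\<lambda>n. star (a ^ n /\<^sub>R fact n)) sums star (exp a)"
    by (rule bounded_linear.sums[OF bounded_linear_star exp_converges])
  then have "(\<lambda>n. star a ^ n /\<^sub>R fact n) sums star (exp a)"
    by (simp add: star_scaleR star_power)
  then show ?thesis using exp_converges sums_unique2 by blast
qed

text \<open>Since \<open>\<i> *\<^sub>C h\<close> is skew-adjoint, the adjoint of its exponential is
  the exponential of its negative, which is the inverse.\<close>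

lemma exp_skew_unitary:
  fixes h :: "'a::cstar_algebra"
  assumes "star h = h"
  shows "exp (\<i> *\<^sub>C h) \<in> unitaries"
proof -
  have "star (exp (\<i> *\<^sub>C h)) = exp (- (\<i> *\<^sub>C h))"
    by (simp add: star_exp star_scaleC assms)
  then show ?thesis
    using exp_minus_inverse[of "\<i> *\<^sub>C h"] exp_minus_inverse[of "- (\<i> *\<^sub>C h)"]
    by (simp add: unitaries_def)
qed

text \<open>These are the real and imaginary parts of \<open>a\<close>. The norm bounds hold because
  the involution is isometric; they carry estimates from self-adjoint elements to all
  elements.\<close>

lemma selfadjoint_decomposition:
  fixes a :: "'a::cstar_algebra"
  obtains h k where "star h = h" "star k = k" "a = h + \<i> *\<^sub>C k" "norm h \<le> norm a" "norm k \<le> norm a"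
proof -
  define h where "h = (1/2) *\<^sub>C (a + star a)"
  define k where "k = (- \<i>/2) *\<^sub>C (a - star a)"
  have "star h = h" by (simp add: h_def star_scaleC star_add star_star add.commute)
  moreover have "star k = k"
    by (simp add: k_def star_scaleC star_diff star_star complex_vector.scale_right_diff_distrib)
  moreover have "a = h + \<i> *\<^sub>C k"
  proof -
    have "h + \<i> *\<^sub>C k = (1/2) *\<^sub>C a + (1/2) *\<^sub>C a"
      by (simp add: h_def k_def scaleC_scaleC complex_vector.scale_right_diff_distrib scaleC_add_right)
    then show ?thesis by (simp flip: scaleC_add_left)
  qed
  moreover have "norm h \<le> norm a"
    using norm_triangle_ineq[of a "star a"] by (simp add: h_def norm_scaleC)
  moreover have "norm k \<le> norm a"
    using norm_triangle_ineq4[of a "star a"] by (simp add: k_def norm_scaleC norm_divide)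
  ultimately show thesis using that by blast
qed

lemma scaleC_scaleR: "c *\<^sub>C r *\<^sub>R a = r *\<^sub>R c *\<^sub>C (a :: 'a::cstar_algebra)"
  by (metis mult.commute scaleC_complex_of_real scaleC_scaleC)

lemma exp_difference_quotient:
  fixes A :: "'a::{real_normed_algebra_1,banach}"
  shows "((\<lambda>t. (exp (t *\<^sub>R A) - 1) /\<^sub>R t) \<longlongrightarrow> A) (at 0)"
proof -
  have "((\<lambda>t. exp (t *\<^sub>R A)) has_vector_derivative A) (at 0)"
    using exp_scaleR_has_vector_derivative_right[of A 0 UNIV] by simp
  then have "((\<lambda>t. norm ((exp (t *\<^sub>R A) - 1) - t *\<^sub>R A) / norm t) \<longlongrightarrow> 0) (at 0)"
    by (simp add: has_vector_derivative_def has_derivative_iff_norm)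
  moreover have "\<forall>\<^sub>F t in at 0. norm ((exp (t *\<^sub>R A) - 1) - t *\<^sub>R A) / norm t
      = norm ((exp (t *\<^sub>R A) - 1) /\<^sub>R t - A)"
  \<comment> \<open>The radius 1 is arbitrary: the two expressions are equal for every nonzero
    \<open>t\<close>.\<close>
  proof (rule eventually_mono[OF eventually_at_ball'[of 1]])
    fix t :: real
    assume t: "t \<in> ball 0 1 \<and> t \<noteq> 0 \<and> t \<in> UNIV"
    then have "(exp (t *\<^sub>R A) - 1) /\<^sub>R t - A = ((exp (t *\<^sub>R A) - 1) - t *\<^sub>R A) /\<^sub>R t"
      by (simp add: scaleR_right_diff_distrib)
    then show "norm ((exp (t *\<^sub>R A) - 1) - t *\<^sub>R A) / norm t
        = norm ((exp (t *\<^sub>R A) - 1) /\<^sub>R t - A)"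
      by (simp add: divide_inverse mult.commute)
  qed simp
  ultimately have "((\<lambda>t. norm ((exp (t *\<^sub>R A) - 1) /\<^sub>R t - A)) \<longlongrightarrow> 0) (at 0)"
    using tendsto_cong by fast
  then show ?thesis
    using LIM_zero_iff tendsto_norm_zero_iff by blast
qed

text \<open>This form of the density of the span of the exponentials serves twice: for the closed
  span of the normalizers, and for the set of right factors at which a state is
  multiplicative.\<close>

lemma closed_subspace_eq_UNIV:
  fixes S :: "'a::cstar_algebra set"
  assumes S: "complex_vector.subspace S" and "closed S"
    and exp_mem: "\<And>h. star h = h \<Longrightarrow> exp (\<i> *\<^sub>C h) \<in> S"
  shows "S = UNIV"
proof -
  have sa: "h \<in> S" if h: "star h = h" for h :: 'a
  proof -
    define A where "A = \<i> *\<^sub>C h"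
    have E: "exp (t *\<^sub>R A) \<in> S" for t
      using exp_mem[of "t *\<^sub>R h"] h by (simp add: A_def star_scaleR scaleC_scaleR)
    \<comment> \<open>The unit lies in \<open>S\<close> as the exponential at parameter 0. At
      \<open>t = 0\<close> the quotient is 0, by the convention
      \<open>inverse 0 = 0\<close>.\<close>
    have "(exp (t *\<^sub>R A) - 1) /\<^sub>R t \<in> S" for t
      using complex_vector.subspace_scale[OF S complex_vector.subspace_diff[OF S E[of t] E[of 0]],
          of "complex_of_real (inverse t)"]
      by (simp only: scaleC_complex_of_real scaleR_zero_left exp_zero)
    then have "A \<in> S"
      using Lim_in_closed_set[OF \<open>closed S\<close> _ _ exp_difference_quotient[of A]] by simp
    then have "(- \<i>) *\<^sub>C A \<in> S" using S complex_vector.subspace_scale by blast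
    then show ?thesis by (simp add: A_def scaleC_scaleC)
  qed
  have "a \<in> S" for a
  proof -
    obtain h k where "star h = h" "star k = k" "a = h + \<i> *\<^sub>C k"
      by (rule selfadjoint_decomposition)
    then show ?thesis
      using sa S by (simp add: complex_vector.subspace_add complex_vector.subspace_scale)
  qed
  then show ?thesis by blast
qed

lemma bounded_linear_scaleC_right: "bounded_linear (\<lambda>a :: 'a::cstar_algebra. c *\<^sub>C a)"
  by (rule bounded_linear_intro[of _ "cmod c"])
    (simp_all add: scaleC_add_right scaleC_scaleR norm_scaleC mult.commute)

lemma complex_subspace_closure:
  fixes S :: "'a::cstar_algebra set"
  assumes S: "complex_vector.subspace S"
  shows "complex_vector.subspace (closure S)"
proof (rule complex_vector.subspaceI)
  show "0 \<in> closure S"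
    using complex_vector.subspace_0[OF S] closure_subset by blast
next
  fix x y assume "x \<in> closure S" "y \<in> closure S"
  then obtain f g where "\<And>n. f n \<in> S" "f \<longlonglongrightarrow> x" "\<And>n. g n \<in> S" "g \<longlonglongrightarrow> y"
    by (auto simp: closure_sequential)
  then have "\<And>n. f n + g n \<in> S" "(\<lambda>n. f n + g n) \<longlonglongrightarrow> x + y"
    by (auto intro: tendsto_add complex_vector.subspace_add[OF S])
  then show "x + y \<in> closure S" unfolding closure_sequential by (intro exI[of _ "\<lambda>n. f n + g n"]) simp
next
  fix c x assume "x \<in> closure S"
  then obtain f where "\<And>n. f n \<in> S" "f \<longlonglongrightarrow> x"
    by (auto simp: closure_sequential)
  then have "\<And>n. c *\<^sub>C f n \<in> S" "(\<lambda>n. c *\<^sub>C f n) \<longlonglongrightarrow> c *\<^sub>C x"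
    by (auto intro: bounded_linear.tendsto[OF bounded_linear_scaleC_right]
        complex_vector.subspace_scale[OF S])
  then show "c *\<^sub>C x \<in> closure S" unfolding closure_sequential by (intro exI[of _ "\<lambda>n. c *\<^sub>C f n"]) simp
qed

section \<open>Linear functionals and the automatic continuity of states\<close>

lemma clinear_functional_iff:
  "clinear_functional \<rho> \<longleftrightarrow>
    (\<forall>a b. \<rho> (a + b) = \<rho> a + \<rho> b) \<and> (\<forall>c a. \<rho> (c *\<^sub>C (a :: 'a::cstar_algebra)) = c * \<rho> a)"
proof -
  have "vector_space ((*) :: complex \<Rightarrow> complex \<Rightarrow> complex)"
    by unfold_locales (simp_all add: algebra_simps)
  then show ?thesis
    by (simp add: Vector_Spaces.linear_iff complex_vector.vector_space_axioms)
qed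

lemma bounded_linear_clinear_functional:
  assumes "clinear_functional \<rho>" and "\<And>a :: 'a::cstar_algebra. cmod (\<rho> a) \<le> norm a * K"
  shows "bounded_linear \<rho>"
proof (rule bounded_linear_intro[of _ K])
  show "\<rho> (r *\<^sub>R a) = r *\<^sub>R \<rho> a" for r a
    using assms(1) scaleC_complex_of_real[of r a]
    by (metis clinear_functional_iff scaleR_conv_of_real)
qed (use assms in \<open>auto simp: clinear_functional_iff\<close>)

text \<open>The square root is \<open>1 - y\<close>, with \<open>y\<close> the fixed point of the contraction \<open>y \<mapsto> (b + y\<^sup>2) / 2\<close>.\<close>

lemma sqrt_one_minus:
  fixes b :: "'a::cstar_algebra"
  assumes b: "star b = b" "norm b \<le> 1/2"
  obtains s where "star s = s" "s * s = 1 - b"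
proof -
  \<comment> \<open>On this ball the norm of \<open>f y\<close> is at most (1/2 + 1/4) / 2 < 1/2,
    and \<open>f\<close> has Lipschitz constant 1/2. Restricting to self-adjoint \<open>y\<close>
    makes the root self-adjoint; this set is closed, hence complete.\<close>
  define S where "S = {y :: 'a. star y = y} \<inter> cball 0 (1/2)"
  define f where "f y = (b + y * y) /\<^sub>R 2" for y
  have "closed {y :: 'a. star y = y}"
    by (intro closed_Collect_eq continuous_on_id linear_continuous_on bounded_linear_star)
  then have "complete S" unfolding S_def complete_eq_closed by blast
  moreover have "S \<noteq> {}" using b by (auto simp: S_def)
  moreover have "f ` S \<subseteq> S"
  proof (rule image_subsetI)
    fix y assume "y \<in> S"
    then have y: "star y = y" "norm y \<le> 1/2" by (simp_all add: S_def)
    have "norm (y * y) \<le> (1/2) * (1/2)"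
      by (rule order_trans[OF norm_mult_ineq mult_mono]) (use y in auto)
    then show "f y \<in> S"
      using norm_triangle_ineq[of b "y * y"] b y
      by (simp add: S_def f_def star_scaleR star_add star_mult)
  qed
  moreover have "dist (f y) (f z) \<le> (1/2) * dist y z" if "y \<in> S" "z \<in> S" for y z
  proof -
    have "y * y - z * z = y * (y - z) + (y - z) * z" by (simp add: algebra_simps)
    then have "norm (y * y - z * z) \<le> norm (y * (y - z)) + norm ((y - z) * z)"
      using norm_triangle_ineq by metis
    also have "\<dots> \<le> norm y * norm (y - z) + norm (y - z) * norm z"
      by (intro add_mono norm_mult_ineq)
    also have "\<dots> \<le> (1/2) * norm (y - z) + norm (y - z) * (1/2)"
      using that by (intro add_mono mult_mono) (auto simp: S_def)
    finally have "norm (y * y - z * z) \<le> norm (y - z)" by simp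
    moreover have "f y - f z = (y * y - z * z) /\<^sub>R 2"
      by (simp add: f_def algebra_simps)
    ultimately show ?thesis by (simp add: dist_norm)
  qed
  ultimately obtain y where y: "y \<in> S" "f y = y"
    using Banach_fix[of S "1/2" f] by auto
  have "b + y * y = 2 *\<^sub>R f y" by (simp add: f_def)
  then have "b + y * y = y + y" using y by (simp add: scaleR_2)
  then have "(1 - y) * (1 - y) = 1 - b" by (simp add: algebra_simps)
  then show thesis using that[of "1 - y"] y by (simp add: S_def star_diff)
qed

text \<open>Positivity at \<open>a + c *\<^sub>C 1\<close> forces
  \<open>c * \<rho> (star a) + cnj c * \<rho> a\<close> to be real for every \<open>c\<close>.
  Taking \<open>c = 1\<close> compares the imaginary parts, and \<open>c = \<i>\<close> the real
  parts.\<close>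

lemma state_star:
  fixes a :: "'a::cstar_algebra"
  assumes "state \<rho>"
  shows "\<rho> (star a) = cnj (\<rho> a)"
proof -
  have lin: "\<rho> (x + y) = \<rho> x + \<rho> y" "\<rho> (c *\<^sub>C x) = c * \<rho> x" for x y c
    using assms by (auto simp: state_def clinear_functional_iff)
  have im: "Im (\<rho> (star x * x)) = 0" for x
    using assms by (auto simp: state_def complex_nonneg_Reals_iff)
  have [simp]: "\<rho> 1 = 1" using assms by (simp add: state_def)
  have "Im (\<rho> (star (a + c *\<^sub>C 1) * (a + c *\<^sub>C 1)))
      = Im (c * \<rho> (star a) + cnj c * \<rho> a)" for c
    using im[of a] by (simp add: star_add star_scaleC distrib_left distrib_right
        mult_scaleC_left mult_scaleC_right lin scaleC_scaleC)
  from this[of 1] this[of \<i>] show ?thesis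
    unfolding im by (simp add: complex_eq_iff)
qed

text \<open>If \<open>h\<close> is self-adjoint of norm at most 1/2, then \<open>1 - h\<close> is
  the square of a self-adjoint element, so positivity gives \<open>Re (\<rho> h) \<le> 1\<close>.
  Scaling yields the constant 2 on self-adjoint elements, and their real and imaginary parts yield 4
  in general.\<close>

lemma state_bounded_linear:
  fixes \<rho> :: "'a::cstar_algebra \<Rightarrow> complex"
  assumes st: "state \<rho>"
  shows "bounded_linear \<rho>"
proof -
  have cl: "clinear_functional \<rho>" using st by (simp add: state_def)
  then have lin: "\<rho> (x + y) = \<rho> x + \<rho> y" "\<rho> (c *\<^sub>C x) = c * \<rho> x" for x y c
    by (auto simp: clinear_functional_iff)
  have one: "\<rho> 1 = 1" using st by (simp add: state_def)
  have re: "Re (\<rho> h) \<le> 2 * norm h" if h: "star h = h" for h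
  proof (cases "h = 0")
    case True
    then show ?thesis using lin(1)[of 0 0] by simp
  next
    case False
    \<comment> \<open>This factor brings \<open>h\<close> to norm exactly 1/2, the limit allowed by
      \<open>sqrt_one_minus\<close>.\<close>
    define r where "r = inverse (2 * norm h)"
    have "star (r *\<^sub>R h) = r *\<^sub>R h" "norm (r *\<^sub>R h) \<le> 1/2"
      using h False by (auto simp: star_scaleR r_def)
    then obtain s where s: "star s = s" "s * s = 1 - r *\<^sub>R h" by (rule sqrt_one_minus)
    have "1 - r *\<^sub>R h = 1 + complex_of_real (- r) *\<^sub>C h"
      by (simp only: scaleC_complex_of_real) simp
    then have "\<rho> (star s * s) = 1 - r * \<rho> h" using s by (simp only: lin one) simp
    moreover have "0 \<le> Re (\<rho> (star s * s))"
      using st by (auto simp: state_def complex_nonneg_Reals_iff)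
    ultimately have "r * Re (\<rho> h) \<le> 1" by simp
    then show ?thesis using False by (simp add: r_def field_simps)
  qed
  have sa: "cmod (\<rho> h) \<le> 2 * norm h" if h: "star h = h" for h
  proof -
    have "\<rho> (- h) = - \<rho> h" using lin(2)[of "-1" h] by simp
    then have "\<bar>Re (\<rho> h)\<bar> \<le> 2 * norm h" using re[of h] re[of "- h"] h by simp
    moreover have "Im (\<rho> h) = 0" using state_star[OF st, of h] h by (simp add: complex_eq_iff)
    ultimately show ?thesis by (simp add: cmod_def)
  qed
  show ?thesis
  proof (rule bounded_linear_clinear_functional[OF cl, where K = 4])
    fix a :: 'a
    obtain h k where hk: "star h = h" "star k = k" "a = h + \<i> *\<^sub>C k" "norm h \<le> norm a" "norm k \<le> norm a"
      by (rule selfadjoint_decomposition)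
    have "cmod (\<rho> a) \<le> cmod (\<rho> h) + cmod (\<i> * \<rho> k)"
      unfolding hk(3) lin by (rule norm_triangle_ineq)
    then show "cmod (\<rho> a) \<le> norm a * 4"
      using sa[OF hk(1)] sa[OF hk(2)] hk(4,5) by (simp add: norm_mult)
  qed
qed

section \<open>Multiplicativity of states at unitaries\<close>

text \<open>This is the degenerate case of Cauchy--Schwarz. In the positive value of
  \<open>\<rho>\<close> at the square of \<open>star x + c *\<^sub>C v\<close> the term quadratic in
  \<open>c\<close> vanishes, so a nonzero linear term could be made arbitrarily negative.\<close>

lemma state_null:
  fixes x v :: "'a::cstar_algebra"
  assumes st: "state \<rho>" and v: "\<rho> (star v * v) = 0"
  shows "\<rho> (x * v) = 0"
proof (rule ccontr)
  assume ne: "\<rho> (x * v) \<noteq> 0"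
  have lin: "\<rho> (x + y) = \<rho> x + \<rho> y" "\<rho> (c *\<^sub>C x) = c * \<rho> x" for x y c
    using st by (auto simp: state_def clinear_functional_iff)
  define z where "z = \<rho> (x * v)"
  define p where "p = Re (\<rho> (x * star x))"
  \<comment> \<open>With this \<open>t\<close> and \<open>c\<close>, the product
    \<open>c * z\<close> is real and the value of the positive expression becomes
    \<open>p - (p + 1) = -1\<close>.\<close>
  define t where "t = (p + 1) / (2 * (cmod z)\<^sup>2)"
  define c where "c = - complex_of_real t * cnj z"
  have z': "\<rho> (star v * star x) = cnj z"
    using state_star[OF st, of "x * v"] by (simp add: star_mult z_def)
  have "star (star x + c *\<^sub>C v) * (star x + c *\<^sub>C v)
      = x * star x + c *\<^sub>C (x * v) + cnj c *\<^sub>C (star v * star x) + (cnj c * c) *\<^sub>C (star v * v)"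
    by (simp add: star_add star_star star_scaleC distrib_left distrib_right mult_scaleC_left
        mult_scaleC_right scaleC_scaleC scaleC_add_right add_ac mult.commute)
  then have "\<rho> (star (star x + c *\<^sub>C v) * (star x + c *\<^sub>C v))
      = \<rho> (x * star x) + c * z + cnj c * cnj z"
    by (simp add: lin v z' flip: z_def)
  moreover have "0 \<le> Re (\<rho> (star (star x + c *\<^sub>C v) * (star x + c *\<^sub>C v)))"
    using st by (auto simp: state_def complex_nonneg_Reals_iff)
  moreover have "c * z = complex_of_real (- t * (cmod z)\<^sup>2)"
    by (simp only: c_def of_real_mult complex_norm_square) simp
  moreover have "cnj c * cnj z = cnj (c * z)" by simp
  ultimately have "0 \<le> p - 2 * t * (cmod z)\<^sup>2" by (simp add: p_def)
  moreover have "2 * t * (cmod z)\<^sup>2 = p + 1" using ne by (simp add: t_def z_def)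
  ultimately show False by simp
qed

text \<open>For \<open>v = u - \<rho> u\<close> one has
  \<open>\<rho> (star v * v) = 1 - \<bar>\<rho> u\<bar>\<^sup>2 = 0\<close>, so
  \<open>\<rho>\<close> vanishes at \<open>x * v\<close> by \<open>state_null\<close>.\<close>

lemma state_mult_unitary:
  fixes x u :: "'a::cstar_algebra"
  assumes st: "state \<rho>" and u: "u \<in> unitaries" "cmod (\<rho> u) = 1"
  shows "\<rho> (x * u) = \<rho> x * \<rho> u"
proof -
  have lin: "\<rho> (x + y) = \<rho> x + \<rho> y" "\<rho> (c *\<^sub>C x) = c * \<rho> x" for x y c
    using st by (auto simp: state_def clinear_functional_iff)
  have [simp]: "\<rho> 1 = 1" using st by (simp add: state_def)
  define v where "v = u + (- \<rho> u) *\<^sub>C 1"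
  have uu: "\<rho> u * cnj (\<rho> u) = 1" using u(2) complex_norm_square[of "\<rho> u"] by simp
  have "star v * v = 1 + (- \<rho> u) *\<^sub>C star u + (- cnj (\<rho> u)) *\<^sub>C u + (\<rho> u * cnj (\<rho> u)) *\<^sub>C 1"
    using u(1) by (simp add: v_def unitaries_def star_add star_scaleC distrib_left distrib_right
        mult_scaleC_left mult_scaleC_right scaleC_scaleC scaleC_add_right add_ac mult.commute
        del: complex_vector.scale_minus_left)
  then have "\<rho> (star v * v) = 0"
    using uu by (simp only: lin state_star[OF st]) (simp add: mult.commute)
  then have "\<rho> (x * v) = 0" by (rule state_null[OF st])
  moreover have "x * v = x * u + (- \<rho> u) *\<^sub>C x"
    unfolding v_def distrib_left mult_scaleC_right by simp
  ultimately show ?thesis by (simp only: lin) (simp add: mult.commute)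
qed

section \<open>Characters are contractive and Hermitian\<close>

text \<open>Otherwise \<open>a\<close> rescales to some \<open>x\<close> with
  \<open>\<phi> x = 1\<close> and norm below 1. Its Neumann series \<open>y\<close> satisfies
  \<open>y = 1 + x * y\<close>, which forces \<open>\<phi> 1 = 0\<close> and contradicts
  \<open>\<phi> (x * 1) = 1\<close>.\<close>

lemma character_bounded:
  fixes \<phi> :: "'a::cstar_algebra \<Rightarrow> complex"
  assumes "\<phi> \<in> characters"
  shows "cmod (\<phi> a) \<le> norm a"
proof (rule ccontr)
  assume big: "\<not> cmod (\<phi> a) \<le> norm a"
  have lin: "\<phi> (x + y) = \<phi> x + \<phi> y" "\<phi> (c *\<^sub>C x) = c * \<phi> x" "\<phi> (x * y) = \<phi> x * \<phi> y" for x y c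
    using assms by (auto simp: characters_def clinear_functional_iff)
  define x where "x = inverse (\<phi> a) *\<^sub>C a"
  have "\<phi> a \<noteq> 0" using big by auto
  then have "\<phi> x = 1" by (simp add: x_def lin)
  have "norm x < 1" using big \<open>\<phi> a \<noteq> 0\<close>
    by (simp add: x_def norm_scaleC norm_inverse inverse_eq_divide[of "cmod (\<phi> a)"])
  then have sm: "summable (\<lambda>n. x ^ n)" by (rule complete_algebra_summable_geometric)
  define y where "y = (\<Sum>n. x ^ n)"
  have "y = 1 + x * y"
    using suminf_split_head[OF sm] suminf_mult[OF sm, of x] by (simp add: y_def)
  then have "\<phi> y = \<phi> 1 + \<phi> x * \<phi> y" by (metis lin(1,3))
  then have "\<phi> 1 = 0" using \<open>\<phi> x = 1\<close> by simp
  then show False using lin(3)[of x 1] \<open>\<phi> x = 1\<close> by simp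
qed

lemma character_one:
  assumes "\<phi> \<in> (characters :: ('a::cstar_algebra \<Rightarrow> complex) set)"
  shows "\<phi> 1 = 1"
proof -
  obtain a where "\<phi> a \<noteq> 0" using assms by (auto simp: characters_def fun_eq_iff)
  moreover have "\<phi> (a * 1) = \<phi> a * \<phi> 1" using assms unfolding characters_def by blast
  ultimately show ?thesis by simp
qed

text \<open>For self-adjoint \<open>h\<close>, compare \<open>\<bar>\<phi> (h + i t)\<bar>\<^sup>2\<close> with
  \<open>\<parallel>h + i t\<parallel>\<^sup>2 \<le> \<parallel>h\<parallel>\<^sup>2 + t\<^sup>2\<close> for a large real \<open>t\<close> of the sign of \<open>Im (\<phi> h)\<close>.\<close>

lemma character_selfadjoint_real:
  fixes h :: "'a::cstar_algebra"
  assumes ch: "\<phi> \<in> characters" and h: "star h = h"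
  shows "Im (\<phi> h) = 0"
proof (rule ccontr)
  assume ne: "Im (\<phi> h) \<noteq> 0"
  have lin: "\<phi> (x + y) = \<phi> x + \<phi> y" "\<phi> (c *\<^sub>C x) = c * \<phi> x" for x y c
    using ch by (auto simp: characters_def clinear_functional_iff)
  define b where "b = Im (\<phi> h)"
  \<comment> \<open>Then \<open>b * t\<close> is the square of \<open>norm h\<close>, so the cross
    term of the square of \<open>b + t\<close> is twice that square and exceeds what the norm bound
    allows.\<close>
  define t where "t = (norm h)\<^sup>2 / b"
  define w where "w = h + (\<i> * t) *\<^sub>C 1"
  have "(\<i> * t) * (\<i> * t) = - complex_of_real (t * t)" by (simp add: complex_eq_iff)
  then have "star w * w = h * h + complex_of_real (t\<^sup>2) *\<^sub>C 1"
    by (simp add: w_def star_add star_scaleC h distrib_left distrib_right mult_scaleC_left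
        mult_scaleC_right scaleC_scaleC power2_eq_square left_diff_distrib
        complex_vector.scale_right_diff_distrib)
  then have "star w * w = h * h + t\<^sup>2 *\<^sub>R 1" by (simp only: scaleC_complex_of_real)
  then have "norm (star w * w) \<le> norm (h * h) + norm (t\<^sup>2 *\<^sub>R (1 :: 'a))"
    by (metis norm_triangle_ineq)
  also have "\<dots> = (norm h)\<^sup>2 + t\<^sup>2" using norm_star_mult_self[of h] h by simp
  finally have "(norm w)\<^sup>2 \<le> (norm h)\<^sup>2 + t\<^sup>2" by (simp add: norm_star_mult_self)
  moreover have "(cmod (\<phi> w))\<^sup>2 \<le> (norm w)\<^sup>2"
    using character_bounded[OF ch, of w] by (intro power_mono) auto
  moreover have "(cmod (\<phi> w))\<^sup>2 = (Re (\<phi> h))\<^sup>2 + (b + t)\<^sup>2"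
    by (simp add: w_def lin character_one[OF ch] cmod_power2 b_def)
  ultimately have "(b + t)\<^sup>2 \<le> (norm h)\<^sup>2 + t\<^sup>2"
    using zero_le_power2[of "Re (\<phi> h)"] by linarith
  moreover have "b * t = (norm h)\<^sup>2" using ne by (simp add: t_def b_def)
  moreover have "0 < b\<^sup>2" using ne by (simp add: b_def)
  ultimately show False
    using zero_le_power2[of "norm h"] by (simp add: power2_sum)
qed

lemma character_star:
  fixes a :: "'a::cstar_algebra"
  assumes ch: "\<phi> \<in> characters"
  shows "\<phi> (star a) = cnj (\<phi> a)"
proof -
  have lin: "\<phi> (x + y) = \<phi> x + \<phi> y" "\<phi> (c *\<^sub>C x) = c * \<phi> x" for x y c
    using ch by (auto simp: characters_def clinear_functional_iff)
  obtain h k where hk: "star h = h" "star k = k" "a = h + \<i> *\<^sub>C k"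
    by (rule selfadjoint_decomposition)
  have "star a = h + (- \<i>) *\<^sub>C k" by (simp add: hk star_add star_scaleC)
  then show ?thesis
    using character_selfadjoint_real[OF ch hk(1)] character_selfadjoint_real[OF ch hk(2)]
    by (simp only: hk(3) lin) (simp add: complex_eq_iff)
qed

lemma characters_subset_compatible_states:
  "characters \<subseteq> compatible_states (D :: 'a::cstar_algebra set)"
proof
  fix \<phi> :: "'a \<Rightarrow> complex" assume ch: "\<phi> \<in> characters"
  have "\<phi> (star a * a) = complex_of_real ((cmod (\<phi> a))\<^sup>2)" for a
  proof -
    have "\<phi> (star a * a) = \<phi> (star a) * \<phi> a" using ch unfolding characters_def by blast
    then show ?thesis
      using complex_norm_square[of "\<phi> a"] by (simp add: character_star[OF ch] mult.commute)
  qed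
  then show "\<phi> \<in> compatible_states D"
    using ch character_one[OF ch] by (auto simp: compatible_states_def state_def characters_def)
qed

section \<open>Compatible states and the main equivalence\<close>

text \<open>Since \<open>star u * u = 1\<close> for a unitary, compatibility leaves only the moduli
  0 and 1. Along the path from the unit to the given exponential the modulus is continuous and
  starts at 1, so it cannot jump to 0.\<close>

lemma compatible_state_norm_exp:
  fixes h :: "'a::cstar_algebra"
  assumes \<rho>: "\<rho> \<in> compatible_states D" and U: "unitaries \<subseteq> normalizers D" and h: "star h = h"
  shows "cmod (\<rho> (exp (\<i> *\<^sub>C h))) = 1"
proof -
  have st: "state \<rho>" using \<rho> by (simp add: compatible_states_def)
  then have one: "\<rho> 1 = 1" by (simp add: state_def)
  define g where "g t = cmod (\<rho> (exp (t *\<^sub>R \<i> *\<^sub>C h)))" for t :: real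
  have g01: "g t \<in> {0, 1}" for t
  proof -
    define u where "u = exp (t *\<^sub>R \<i> *\<^sub>C h)"
    have u: "u \<in> unitaries"
      using exp_skew_unitary[of "t *\<^sub>R h"] h by (simp add: u_def star_scaleR scaleC_scaleR)
    then have "complex_of_real ((cmod (\<rho> u))\<^sup>2) \<in> {0, \<rho> (star u * u)}"
      using \<rho> U by (auto simp: compatible_states_def)
    then have "(cmod (\<rho> u))\<^sup>2 \<in> {0, 1}"
      using u one by (auto simp: unitaries_def simp flip: of_real_power)
    then have "cmod (\<rho> u) \<in> {0, 1}"
      using norm_ge_zero[of "\<rho> u"] unfolding insert_iff power2_eq_1_iff by fastforce
    then show ?thesis by (simp add: g_def u_def)
  qed
  have "continuous_on UNIV (\<lambda>t. exp (t *\<^sub>R \<i> *\<^sub>C h))"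
    using exp_scaleR_has_vector_derivative_right has_vector_derivative_continuous
    by (metis continuous_at_imp_continuous_on)
  then have "continuous_on UNIV g"
    unfolding g_def
    by (intro continuous_on_norm bounded_linear.continuous_on[OF state_bounded_linear[OF st]])
  moreover have "finite (range g)"
    by (rule finite_subset[of _ "{0, 1}"]) (use g01 in auto)
  \<comment> \<open>A continuous function with finite range on the connected real line is
    constant.\<close>
  ultimately have "g constant_on UNIV"
    using continuous_finite_range_constant[of UNIV g] by auto
  then have "g 1 = g 0" by (auto simp: constant_on_def)
  then show ?thesis using one by (simp add: g_def)
qed

lemma compatible_states_subset_characters:
  fixes D :: "'a::cstar_algebra set"
  assumes U: "unitaries \<subseteq> normalizers D"
  shows "compatible_states D \<subseteq> characters"
proof
  fix \<rho> assume \<rho>: "\<rho> \<in> compatible_states D"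
  then have st: "state \<rho>" by (simp add: compatible_states_def)
  then have cl: "clinear_functional \<rho>" and one: "\<rho> 1 = 1" by (simp_all add: state_def)
  then have lin: "\<rho> (x + y) = \<rho> x + \<rho> y" "\<rho> (c *\<^sub>C x) = c * \<rho> x" for x y c
    by (auto simp: clinear_functional_iff)
  have z: "\<rho> 0 = 0" using lin(1)[of 0 0] by simp
  have cont: "continuous_on UNIV (\<lambda>a. \<rho> (f a))" if "continuous_on UNIV f" for f :: "'a \<Rightarrow> 'a"
    using bounded_linear.continuous_on[OF state_bounded_linear[OF st] that] .
  \<comment> \<open>With \<open>x\<close> quantified inside, the set is an intersection of closed
    subspaces, one for each \<open>x\<close>; closedness uses the continuity of
    \<open>\<rho>\<close>.\<close>
  have "{y. \<forall>x. \<rho> (x * y) = \<rho> x * \<rho> y} = UNIV"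
  proof (rule closed_subspace_eq_UNIV)
    show "complex_vector.subspace {y. \<forall>x. \<rho> (x * y) = \<rho> x * \<rho> y}"
      by (rule complex_vector.subspaceI) (simp_all add: z lin distrib_left mult_scaleC_right)
    show "closed {y. \<forall>x. \<rho> (x * y) = \<rho> x * \<rho> y}"
      by (intro closed_Collect_all closed_Collect_eq cont continuous_intros)
    show "exp (\<i> *\<^sub>C h) \<in> {y. \<forall>x. \<rho> (x * y) = \<rho> x * \<rho> y}" if "star h = h" for h
      using state_mult_unitary[OF st exp_skew_unitary[OF that]
          compatible_state_norm_exp[OF \<rho> U that]] by simp
  qed
  then have "\<rho> (x * y) = \<rho> x * \<rho> y" for x y by blast
  then show "\<rho> \<in> characters" using cl one by (auto simp: characters_def)
qed

theorem theorem4p8: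
  fixes D :: "'a::cstar_algebra set"
  assumes "inclusion D"
    and "unitaries \<subseteq> normalizers D"
  shows "regular_inclusion D \<and> compatible_states D = characters"
proof
  have "closure (complex_vector.span (normalizers D)) = UNIV"
  proof (rule closed_subspace_eq_UNIV)
    show "complex_vector.subspace (closure (complex_vector.span (normalizers D)))"
      by (intro complex_subspace_closure complex_vector.subspace_span)
    show "exp (\<i> *\<^sub>C h) \<in> closure (complex_vector.span (normalizers D))" if "star h = h" for h
      using exp_skew_unitary[OF that] assms(2) complex_vector.span_base closure_subset by blast
  qed simp
  with assms(1) show "regular_inclusion D" by (simp add: regular_inclusion_def)
  show "compatible_states D = characters"
    using characters_subset_compatible_states compatible_states_subset_characters[OF assms(2)]
    by blast
qed

end
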